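(* Suppose that $c(\cdot)$ is $L_c$-Lipschitz on $S$, i.e. $\|c(w_1)-c(w_2)\|_2\le L_c\|w_1-w_2\|$ for all $w_1,w_2\in S$, and that $\phi$ is 1-strongly convex on $S$. For a given $\rho>0$, let $\tilde w_\rho(\cdot)$ be the approximate optimal solution mapping obtained by applying the Bernstein approximation of order $s$ separately to each coordinate function $w_{\rho,j}(\cdot)$, i.e. $\tilde w_{\rho,j}:=B_s(w_{\rho,j})$, $j=1,\dots,d$. Then $\tilde w_\rho$ satisfies the uniform error bound $$|w_{\rho,j}(p)-\tilde w_{\rho,j}(p)|\le\frac{\Omega L_c}{\rho\sqrt s}\qquad\forall p\in\Delta_K,\ j=1,\dots,d,$$ where $\Omega>0$ is an absolute constant.
   Context: $S\subset\mathbb{R}^d$ is a nonempty convex compact set and $\|\cdot\|$ is a norm on $\mathbb{R}^d$. $c_1,\dots,c_K:S\to\mathbb{R}$ are convex and $c(\cdot):S\to\mathbb{R}^K$ denotes $w\mapsto(c_1(w),\dots,c_K(w))$. $\phi:S\to\mathbb{R}$ is non-negative and continuous; 1-strong convexity is with respect to $\|\cdot\|$. $\Delta_K:=\{p\in\mathbb{R}^K:\sum_kp_k=1,\ p\ge0\}$. For $p\in\Delta_K$ and $\rho>0$, $w_\rho(p):=\arg\min_{w\in S}\{\sum_{k=1}^Kp_kc_k(w)+\rho\phi(w)\}$ (a single point), with $j$-th coordinate $w_{\rho,j}(p)$. Bernstein approximation of order $s\in\mathbb{N}$, $s\geq 1$, of $\omega:\Delta_K\to\mathbb{R}$: $B_s(\omega)(p):=\sum_{\alpha\in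 I(K,s)}\omega\big(\frac{\alpha}{s}\big)\frac{s!}{\alpha!}p^\alpha$ for $p\in\Delta_K$, where $I(K,s):=\{\alpha\in\mathbb{N}_0^K:\sum_{i=1}^K\alpha_i=s\}$, $\alpha!:=\prod_i\alpha_i!$ and $p^\alpha:=p_1^{\alpha_1}\cdots p_K^{\alpha_K}$.
   Formalization: Since rescaling the norm makes a single absolute constant impossible, Ω is one universal constant only for norms with |x_j| ≤ ‖x‖ for all j (e.g. all ℓ_q norms); for any other norm on R^d, Ω may depend on that norm and d. *)

theory Defs
  imports "HOL-Analysis.Analysis" "HOL-Library.Function_Algebras"
begin

text \<open>
  The dimensions \<open>d\<close> and \<open>K\<close> are quantified inside the statement (the constant must not depend on
  them), so $\mathbb{R}^n$ is rendered as \<open>topspace (Euclidean_space n)\<close>: the functions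
  \<open>nat \<Rightarrow> real\<close> that vanish at all indices \<open>\<ge> n\<close>. Coordinates are numbered \<open>0, \<dots>, n - 1\<close>.
  The pointwise vector space structure below makes \<open>convex\<close> and \<open>convex_on\<close> available on it.
\<close>

instantiation "fun" :: (type, real_vector) real_vector
begin

definition scaleR_fun :: "real \<Rightarrow> ('a \<Rightarrow> 'b) \<Rightarrow> 'a \<Rightarrow> 'b" where
  "scaleR_fun r f = (\<lambda>x. r *\<^sub>R f x)"

instance
  by standard (simp_all add: scaleR_fun_def fun_eq_iff scaleR_add_right scaleR_add_left)

end

lemma scaleR_fun_apply [simp]: "(r *\<^sub>R f) x = r *\<^sub>R f x"
  by (simp add: scaleR_fun_def)

definition is_norm_on_Rn :: "nat \<Rightarrow> ((nat \<Rightarrow> real) \<Rightarrow> real) \<Rightarrow> bool" where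
  "is_norm_on_Rn d N \<longleftrightarrow>
     (\<forall>x\<in>topspace (Euclidean_space d). 0 \<le> N x \<and> (N x = 0 \<longleftrightarrow> x = 0)) \<and>
     (\<forall>x\<in>topspace (Euclidean_space d). \<forall>r. N (r *\<^sub>R x) = \<bar>r\<bar> * N x) \<and>
     (\<forall>x\<in>topspace (Euclidean_space d). \<forall>y\<in>topspace (Euclidean_space d). N (x + y) \<le> N x + N y)"

definition strongly_convex_on ::
  "((nat \<Rightarrow> real) \<Rightarrow> real) \<Rightarrow> real \<Rightarrow> (nat \<Rightarrow> real) set \<Rightarrow> ((nat \<Rightarrow> real) \<Rightarrow> real) \<Rightarrow> bool" where
  "strongly_convex_on N \<mu> S f \<longleftrightarrow> convex S \<and>
     (\<forall>x\<in>S. \<forall>y\<in>S. \<forall>u\<ge>0. \<forall>v\<ge>0. u + v = 1 \<longrightarrow>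
        f (u *\<^sub>R x + v *\<^sub>R y) \<le> u * f x + v * f y - \<mu> / 2 * u * v * (N (x - y))\<^sup>2)"

text \<open>The component functions are \<open>c k\<close> for \<open>k < K\<close>.  As for the library's \<open>lipschitz_on\<close>, a
  Lipschitz constant is non-negative (for a one-point \<open>S\<close> the inequality alone would not force it).\<close>

definition Lipschitz_map_on ::
  "((nat \<Rightarrow> real) \<Rightarrow> real) \<Rightarrow> nat \<Rightarrow> real \<Rightarrow> (nat \<Rightarrow> real) set \<Rightarrow>
   (nat \<Rightarrow> (nat \<Rightarrow> real) \<Rightarrow> real) \<Rightarrow> bool" where
  "Lipschitz_map_on N K L S c \<longleftrightarrow> 0 \<le> L \<and>
     (\<forall>w1\<in>S. \<forall>w2\<in>S. L2_set (\<lambda>k. c k w1 - c k w2) {..<K} \<le> L * N (w1 - w2))"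

definition prob_simplex :: "nat \<Rightarrow> (nat \<Rightarrow> real) set" where
  "prob_simplex K = {p \<in> topspace (Euclidean_space K). (\<Sum>k<K. p k) = 1 \<and> (\<forall>k<K. 0 \<le> p k)}"

definition w_sol ::
  "nat \<Rightarrow> (nat \<Rightarrow> real) set \<Rightarrow> (nat \<Rightarrow> (nat \<Rightarrow> real) \<Rightarrow> real) \<Rightarrow> ((nat \<Rightarrow> real) \<Rightarrow> real) \<Rightarrow> real \<Rightarrow>
   (nat \<Rightarrow> real) \<Rightarrow> (nat \<Rightarrow> real)" where
  "w_sol K S c \<phi> \<rho> p = arg_min_on (\<lambda>w. (\<Sum>k<K. p k * c k w) + \<rho> * \<phi> w) S"

definition multi_indices :: "nat \<Rightarrow> nat \<Rightarrow> (nat \<Rightarrow> nat) set" where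
  "multi_indices K s = {\<alpha>. (\<forall>i\<ge>K. \<alpha> i = 0) \<and> (\<Sum>i<K. \<alpha> i) = s}"

lemma finite_multi_indices: "finite (multi_indices K s)"
proof (rule finite_subset)
  show "multi_indices K s \<subseteq> {f. \<forall>x. (x \<in> {..<K} \<longrightarrow> f x \<in> {..s}) \<and> (x \<notin> {..<K} \<longrightarrow> f x = 0)}"
    by (auto simp: multi_indices_def intro: member_le_sum)
  show "finite {f. \<forall>x. (x \<in> {..<K} \<longrightarrow> f x \<in> {..s}) \<and> (x \<notin> {..<K} \<longrightarrow> f x = (0::nat))}"
    by (rule finite_set_of_finite_funs) auto
qed

definition bernstein :: "nat \<Rightarrow> nat \<Rightarrow> ((nat \<Rightarrow> real) \<Rightarrow> real) \<Rightarrow> (nat \<Rightarrow> real) \<Rightarrow> real" where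
  "bernstein K s \<omega> p =
     (\<Sum>\<alpha>\<in>multi_indices K s.
        \<omega> (\<lambda>i. real (\<alpha> i) / real s) * (fact s / (\<Prod>i<K. fact (\<alpha> i))) * (\<Prod>i<K. p i ^ \<alpha> i))"

definition w_approx ::
  "nat \<Rightarrow> nat \<Rightarrow> (nat \<Rightarrow> real) set \<Rightarrow> (nat \<Rightarrow> (nat \<Rightarrow> real) \<Rightarrow> real) \<Rightarrow> ((nat \<Rightarrow> real) \<Rightarrow> real) \<Rightarrow>
   real \<Rightarrow> (nat \<Rightarrow> real) \<Rightarrow> (nat \<Rightarrow> real)" where
  "w_approx s K S c \<phi> \<rho> p = (\<lambda>j. bernstein K s (\<lambda>q. w_sol K S c \<phi> \<rho> q j) p)"

text \<open>
  The error is measured in coordinates of \<open>w\<close>, whereas the hypotheses only involve the norm \<open>N\<close>;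
  replacing \<open>N\<close> by \<open>\<epsilon> N\<close> shows that one constant cannot serve all norms on $\mathbb{R}^d$.
  The following normalisation holds for every $\ell_q$ norm, in every dimension.
\<close>

definition dominates_coordinates :: "nat \<Rightarrow> ((nat \<Rightarrow> real) \<Rightarrow> real) \<Rightarrow> bool" where
  "dominates_coordinates d N \<longleftrightarrow> (\<forall>x\<in>topspace (Euclidean_space d). \<forall>j<d. \<bar>x j\<bar> \<le> N x)"

end

theory Submission
  imports Defs
begin

text \<open>
  Comparing the objectives at the minimisers \<open>w(p)\<close> and \<open>w(q)\<close>, strong convexity bounds
  \<open>N (w(p) - w(q))\<close> by \<open>2 L\<^sub>c / \<rho>\<close> times the Euclidean distance of \<open>p\<close> and \<open>q\<close>.
  The Bernstein operator averages over \<open>\<alpha> / s\<close> with \<open>\<alpha>\<close> multinomially distributed; \<open>\<alpha> / s\<close> has mean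
  \<open>p\<close> and total variance at most \<open>1 / s\<close>, so a Lipschitz function moves by at most its Lipschitz
  constant divided by \<open>sqrt s\<close>. A general norm only enters through the equivalence of norms.
\<close>

section \<open>Multinomial weights\<close>

text \<open>For \<open>p\<close> in the simplex this is the probability that \<open>s\<close>
  independent draws from \<open>p\<close> produce the counts \<open>\<alpha>\<close>. The Bernstein
  polynomial at \<open>p\<close> is then the expectation of \<omega> at the relative
  frequencies.\<close>

definition multinomial_weight :: "nat \<Rightarrow> nat \<Rightarrow> (nat \<Rightarrow> real) \<Rightarrow> (nat \<Rightarrow> nat) \<Rightarrow> real" where
  "multinomial_weight K s p \<alpha> = fact s / (\<Prod>i<K. fact (\<alpha> i)) * (\<Prod>i<K. p i ^ \<alpha> i)"

lemma bernstein_altdef: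
  "bernstein K s \<omega> p =
     (\<Sum>\<alpha>\<in>multi_indices K s. \<omega> (\<lambda>i. real (\<alpha> i) / real s) * multinomial_weight K s p \<alpha>)"
  by (simp add: bernstein_def multinomial_weight_def mult.assoc)

lemma multinomial_weight_nonneg:
  assumes "\<And>i. i < K \<Longrightarrow> 0 \<le> p i"
  shows "0 \<le> multinomial_weight K s p \<alpha>"
  unfolding multinomial_weight_def using assms
  by (intro mult_nonneg_nonneg divide_nonneg_nonneg prod_nonneg) auto

text \<open>Raising the \<open>j\<close>-th entry adds one factor \<open>Suc (\<beta> j)\<close> to
  the factorials and one factor \<open>p j\<close> to the powers. This termwise identity drives the
  recursion on the sample size.\<close>

lemma multinomial_weight_increment:
  assumes "j < K"
  shows "real (Suc s) * (p j * multinomial_weight K s p \<beta>) =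
         real (Suc (\<beta> j)) * multinomial_weight K (Suc s) p (\<beta>(j := Suc (\<beta> j)))"
proof -
  let ?\<alpha> = "\<beta>(j := Suc (\<beta> j))"
  have split: "(\<Prod>i<K. f i) = f j * (\<Prod>i\<in>{..<K} - {j}. f i)" for f :: "nat \<Rightarrow> real"
    using assms by (simp add: prod.remove)
  have "(\<Prod>i<K. fact (?\<alpha> i) :: real) = real (Suc (\<beta> j)) * (\<Prod>i<K. fact (\<beta> i))"
    unfolding split by (simp add: algebra_simps)
  moreover have "(\<Prod>i<K. p i ^ ?\<alpha> i) = p j * (\<Prod>i<K. p i ^ \<beta> i)"
    unfolding split by simp
  moreover have "(fact (Suc s) :: real) = real (Suc s) * fact s"
    by simp
  moreover have "(\<Prod>i<K. fact (\<beta> i) :: real) \<noteq> 0"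
    by simp
  ultimately show ?thesis
    unfolding multinomial_weight_def by (simp del: of_nat_Suc fact_Suc)
qed

lemma multi_indices_0: "multi_indices K 0 = {\<lambda>_. 0}"
  by (auto simp: multi_indices_def fun_eq_iff) (meson lessThan_iff linorder_not_less)

text \<open>A multinomial sample of size \<open>s + 1\<close> is one of size \<open>s\<close> followed by a further draw.\<close>

lemma multinomial_sum_Suc:
  "(\<Sum>\<alpha>\<in>multi_indices K (Suc s). f \<alpha> * multinomial_weight K (Suc s) p \<alpha>) =
   (\<Sum>j<K. p j * (\<Sum>\<beta>\<in>multi_indices K s. f (\<beta>(j := Suc (\<beta> j))) * multinomial_weight K s p \<beta>))"
proof -
  let ?W = "multinomial_weight K (Suc s) p"
  \<comment> \<open>The factor \<open>\<alpha> j\<close> is exactly what the increment identity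
    leaves on the larger index, so weighting by it permits shifting the summation index in
    coordinate \<open>j\<close>.\<close>
  have inner: "(\<Sum>\<alpha>\<in>multi_indices K (Suc s). real (\<alpha> j) * (f \<alpha> * ?W \<alpha>)) =
      real (Suc s) *
        (p j * (\<Sum>\<beta>\<in>multi_indices K s. f (\<beta>(j := Suc (\<beta> j))) * multinomial_weight K s p \<beta>))"
    if j: "j < K" for j
  proof -
    let ?A = "{\<alpha> \<in> multi_indices K (Suc s). \<alpha> j \<noteq> 0}"
    have total: "(\<Sum>i<K. \<alpha> i) = \<alpha> j + (\<Sum>i\<in>{..<K} - {j}. \<alpha> i)" for \<alpha> :: "nat \<Rightarrow> nat"
      using j by (simp add: sum.remove)
    \<comment> \<open>Indices with \<open>\<alpha> j = 0\<close> contribute nothing. On the others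
      \<open>\<alpha> j - 1\<close> is a genuine predecessor, so lowering and raising the entry are
      mutually inverse.\<close>
    have "(\<Sum>\<alpha>\<in>multi_indices K (Suc s). real (\<alpha> j) * (f \<alpha> * ?W \<alpha>)) =
        (\<Sum>\<alpha>\<in>?A. real (\<alpha> j) * (f \<alpha> * ?W \<alpha>))"
      by (rule sum.mono_neutral_right) (auto simp: finite_multi_indices)
    also have "\<dots> = (\<Sum>\<beta>\<in>multi_indices K s.
        real (Suc s) * (p j * (f (\<beta>(j := Suc (\<beta> j))) * multinomial_weight K s p \<beta>)))"
    proof (rule sum.reindex_bij_witness[where i = "\<lambda>\<beta>. \<beta>(j := Suc (\<beta> j))" and
          j = "\<lambda>\<alpha>. \<alpha>(j := \<alpha> j - 1)"])
      fix \<alpha> assume \<alpha>: "\<alpha> \<in> ?A"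
      let ?\<beta> = "\<alpha>(j := \<alpha> j - 1)"
      show *: "?\<beta>(j := Suc (?\<beta> j)) = \<alpha>"
        using \<alpha> by auto
      show "?\<beta> \<in> multi_indices K s"
        using \<alpha> total[of \<alpha>] total[of ?\<beta>] by (auto simp: multi_indices_def)
      have "real (Suc s) * (p j * multinomial_weight K s p ?\<beta>) = real (\<alpha> j) * ?W \<alpha>"
        using multinomial_weight_increment[OF j, of s p ?\<beta>] \<alpha> unfolding * by simp
      then show "real (Suc s) * (p j * (f (?\<beta>(j := Suc (?\<beta> j))) * multinomial_weight K s p ?\<beta>)) =
          real (\<alpha> j) * (f \<alpha> * ?W \<alpha>)"
        unfolding * by algebra
    next
      fix \<beta> assume \<beta>: "\<beta> \<in> multi_indices K s"
      let ?\<alpha> = "\<beta>(j := Suc (\<beta> j))"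
      show "?\<alpha>(j := ?\<alpha> j - 1) = \<beta>"
        by simp
      show "?\<alpha> \<in> ?A"
        using \<beta> j total[of \<beta>] total[of ?\<alpha>] by (auto simp: multi_indices_def)
    qed
    also have "\<dots> = real (Suc s) *
        (p j * (\<Sum>\<beta>\<in>multi_indices K s. f (\<beta>(j := Suc (\<beta> j))) * multinomial_weight K s p \<beta>))"
      by (simp add: sum_distrib_left)
    finally show ?thesis .
  qed
  \<comment> \<open>The entries of each index add up to \<open>Suc s\<close>, so this factor splits
    into the weights \<open>\<alpha> j\<close> treated by \<open>inner\<close>; it cancels at the
    end.\<close>
  have "real (Suc s) * (\<Sum>\<alpha>\<in>multi_indices K (Suc s). f \<alpha> * ?W \<alpha>) =
      (\<Sum>\<alpha>\<in>multi_indices K (Suc s). (\<Sum>j<K. real (\<alpha> j)) * (f \<alpha> * ?W \<alpha>))"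
    unfolding sum_distrib_left
    by (rule sum.cong) (auto simp: multi_indices_def simp flip: of_nat_sum)
  also have "\<dots> = (\<Sum>j<K. \<Sum>\<alpha>\<in>multi_indices K (Suc s). real (\<alpha> j) * (f \<alpha> * ?W \<alpha>))"
    unfolding sum_distrib_right by (rule sum.swap)
  also have "\<dots> = real (Suc s) * (\<Sum>j<K.
      p j * (\<Sum>\<beta>\<in>multi_indices K s. f (\<beta>(j := Suc (\<beta> j))) * multinomial_weight K s p \<beta>))"
    by (simp add: inner sum_distrib_left del: of_nat_Suc)
  finally show ?thesis
    by (simp del: of_nat_Suc)
qed

text \<open>With \<open>f = 1\<close> the recursion multiplies the total by the sum of the
  \<open>p k\<close> at each further draw.\<close>

lemma multinomial_weight_total:
  assumes "(\<Sum>k<K. p k) = 1"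
  shows "(\<Sum>\<alpha>\<in>multi_indices K s. multinomial_weight K s p \<alpha>) = 1"
proof (induction s)
  case 0
  then show ?case
    by (simp add: multi_indices_0 multinomial_weight_def)
next
  case (Suc s)
  then show ?case
    using multinomial_sum_Suc[of "\<lambda>_. 1" K s p] assms by simp
qed

text \<open>The \<open>k\<close>-th count is binomial with parameters \<open>s\<close> and
  \<open>p k\<close>. In the induction each further draw contributes the variance
  \<open>p k * (1 - p k)\<close> of a single indicator.\<close>

lemma multinomial_variance:
  assumes p: "(\<Sum>k<K. p k) = 1" and k: "k < K"
  shows "(\<Sum>\<alpha>\<in>multi_indices K s. (real (\<alpha> k) - real s * p k)\<^sup>2 * multinomial_weight K s p \<alpha>) =
         real s * (p k * (1 - p k))"
proof (induction s)
  case 0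
  then show ?case
    by (simp add: multi_indices_0)
next
  case (Suc s)
  let ?E = "\<lambda>f. \<Sum>\<beta>\<in>multi_indices K s. f \<beta> * multinomial_weight K s p \<beta>"
  \<comment> \<open>\<open>\<xi>\<close> is the centred count after \<open>s\<close> draws, and
    \<open>\<delta> j\<close> is the centred contribution of the next draw when its outcome is
    \<open>j\<close>.\<close>
  define \<xi> where "\<xi> \<beta> = real (\<beta> k) - real s * p k" for \<beta> :: "nat \<Rightarrow> nat"
  define \<delta> where "\<delta> j = of_bool (j = k) - p k" for j
  have draw: "(\<Sum>j<K. p j * of_bool (j = k)) = p k"
    using k by (simp add: of_bool_def if_distrib cong: if_cong)
  \<comment> \<open>The centred draw has mean zero, which kills the cross term whatever the value of
    \<open>?E \<xi>\<close>.\<close>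
  have mean: "(\<Sum>j<K. p j * \<delta> j) = 0"
    using p draw by (simp add: \<delta>_def right_diff_distrib sum_subtractf flip: sum_distrib_right)
  \<comment> \<open>An indicator equals its own square, so the square is linear in the indicator and
    \<open>draw\<close> applies.\<close>
  have square: "p j * (\<delta> j)\<^sup>2 = (1 - 2 * p k) * (p j * of_bool (j = k)) + p j * (p k)\<^sup>2" for j
    by (simp add: \<delta>_def power2_eq_square algebra_simps)
  have var: "(\<Sum>j<K. p j * (\<delta> j)\<^sup>2) = p k * (1 - p k)"
  proof -
    have "(\<Sum>j<K. p j * (\<delta> j)\<^sup>2) =
        (1 - 2 * p k) * (\<Sum>j<K. p j * of_bool (j = k)) + (\<Sum>j<K. p j) * (p k)\<^sup>2"
      unfolding square
      by (simp only: sum.distrib sum_distrib_left sum_distrib_right)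
    then show ?thesis
      unfolding draw p by (simp add: power2_eq_square algebra_simps)
  qed
  \<comment> \<open>The deviation after the additional draw is
    \<open>\<xi> \<beta> + \<delta> j\<close>; its square is expanded.\<close>
  have "(real ((\<beta>(j := Suc (\<beta> j))) k) - real (Suc s) * p k)\<^sup>2 * multinomial_weight K s p \<beta> =
      (\<xi> \<beta>)\<^sup>2 * multinomial_weight K s p \<beta> + 2 * \<delta> j * (\<xi> \<beta> * multinomial_weight K s p \<beta>)
      + (\<delta> j)\<^sup>2 * multinomial_weight K s p \<beta>" for \<beta> j
    by (simp add: \<xi>_def \<delta>_def power2_eq_square algebra_simps)
  then have "(\<Sum>\<alpha>\<in>multi_indices K (Suc s).
        (real (\<alpha> k) - real (Suc s) * p k)\<^sup>2 * multinomial_weight K (Suc s) p \<alpha>) =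
      (\<Sum>j<K. p j * (?E (\<lambda>\<beta>. (\<xi> \<beta>)\<^sup>2) + 2 * \<delta> j * ?E \<xi> + (\<delta> j)\<^sup>2))"
    unfolding multinomial_sum_Suc
    by (simp add: sum.distrib multinomial_weight_total[OF p] flip: sum_distrib_left)
  also have "\<dots> = (\<Sum>j<K. p j) * ?E (\<lambda>\<beta>. (\<xi> \<beta>)\<^sup>2) + 2 * ?E \<xi> * (\<Sum>j<K. p j * \<delta> j)
      + (\<Sum>j<K. p j * (\<delta> j)\<^sup>2)"
  \<comment> \<open>The two expectations enter as constants \<open>a\<close> and \<open>b\<close>,
    so that the rearrangement leaves their sums closed.\<close>
  proof -
    have "(\<Sum>j<K. p j * (a + 2 * \<delta> j * b + (\<delta> j)\<^sup>2)) =
        (\<Sum>j<K. p j) * a + 2 * b * (\<Sum>j<K. p j * \<delta> j) + (\<Sum>j<K. p j * (\<delta> j)\<^sup>2)" for a b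
      by (simp add: sum.distrib distrib_left sum_distrib_left sum_distrib_right mult_ac)
    then show ?thesis .
  qed
  also have "\<dots> = real (Suc s) * (p k * (1 - p k))"
  proof -
    have "?E (\<lambda>\<beta>. (\<xi> \<beta>)\<^sup>2) = real s * (p k * (1 - p k))"
      using Suc unfolding \<xi>_def .
    then show ?thesis
      unfolding p mean var by (simp add: distrib_right)
  qed
  finally show ?case .
qed

section \<open>Bernstein approximation of Lipschitz functions\<close>

lemma multi_index_in_prob_simplex:
  assumes "\<alpha> \<in> multi_indices K s" "s \<ge> 1"
  shows "(\<lambda>i. real (\<alpha> i) / real s) \<in> prob_simplex K"
  using assms
  by (auto simp: prob_simplex_def multi_indices_def topspace_Euclidean_space
      simp flip: sum_divide_distrib of_nat_sum)

text \<open>The error is at most \<open>M\<close> times the mean distance of the sample point from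
  \<open>p\<close>, and this mean is controlled by the second moment. Only distances from the fixed
  point \<open>p\<close> occur.\<close>

lemma bernstein_error:
  assumes p: "p \<in> prob_simplex K" and s: "s \<ge> 1" and M: "0 \<le> M"
    and lip: "\<And>q. q \<in> prob_simplex K \<Longrightarrow> \<bar>\<omega> p - \<omega> q\<bar> \<le> M * L2_set (\<lambda>k. p k - q k) {..<K}"
  shows "\<bar>\<omega> p - bernstein K s \<omega> p\<bar> \<le> M / sqrt s"
proof -
  let ?W = "multinomial_weight K s p"
  define D where "D \<alpha> = L2_set (\<lambda>k. p k - real (\<alpha> k) / real s) {..<K}" for \<alpha> :: "nat \<Rightarrow> nat"
  have p1: "(\<Sum>k<K. p k) = 1" and p0: "\<And>k. k < K \<Longrightarrow> 0 \<le> p k"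
    using p by (auto simp: prob_simplex_def)
  have W0: "0 \<le> ?W \<alpha>" for \<alpha>
    by (rule multinomial_weight_nonneg) (rule p0)
  have s0: "real s > 0"
    using s by simp
  have D2: "(D \<alpha>)\<^sup>2 = (\<Sum>k<K. (real (\<alpha> k) - real s * p k)\<^sup>2) / (real s)\<^sup>2" for \<alpha>
  proof -
    have "(p k - real (\<alpha> k) / real s)\<^sup>2 = (real (\<alpha> k) - real s * p k)\<^sup>2 / (real s)\<^sup>2" for k
      using s0 by (simp add: field_simps power2_eq_square)
    then show ?thesis
      unfolding D_def L2_set_def by (simp add: sum_nonneg sum_divide_distrib)
  qed
  have "(\<Sum>\<alpha>\<in>multi_indices K s. (D \<alpha>)\<^sup>2 * ?W \<alpha>) =
      (\<Sum>k<K. \<Sum>\<alpha>\<in>multi_indices K s. (real (\<alpha> k) - real s * p k)\<^sup>2 * ?W \<alpha>) / (real s)\<^sup>2"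
    unfolding D2 by (subst sum.swap) (simp add: sum_divide_distrib sum_distrib_right)
  also have "\<dots> = (\<Sum>k<K. real s * (p k * (1 - p k))) / (real s)\<^sup>2"
    by (simp add: multinomial_variance[OF p1])
  also have "\<dots> = (\<Sum>k<K. p k * (1 - p k)) / real s"
    using s0 by (simp add: power2_eq_square flip: sum_distrib_left)
  \<comment> \<open>Bounding \<open>p k * (1 - p k)\<close> by \<open>p k\<close> before summing
    keeps the estimate free of the dimension \<open>K\<close>.\<close>
  also have "\<dots> \<le> 1 / real s"
  proof -
    have "(\<Sum>k<K. p k * (1 - p k)) \<le> (\<Sum>k<K. p k)"
      using p0 by (intro sum_mono) (simp add: algebra_simps)
    then show ?thesis
      using s0 p1 by (simp add: divide_right_mono)
  qed
  finally have var: "(\<Sum>\<alpha>\<in>multi_indices K s. (D \<alpha>)\<^sup>2 * ?W \<alpha>) \<le> 1 / real s" .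
  \<comment> \<open>A linearised Cauchy-Schwarz inequality. The weights are balanced so that, with
    second moment at most \<open>1 / s\<close>, both terms average to at most
    \<open>1 / sqrt s\<close>.\<close>
  have amgm: "D \<alpha> \<le> (sqrt s * (D \<alpha>)\<^sup>2 + 1 / sqrt s) / 2" for \<alpha>
  proof -
    have "0 \<le> (sqrt s * D \<alpha> - 1)\<^sup>2 / sqrt s"
      by simp
    also have "\<dots> = sqrt s * (D \<alpha>)\<^sup>2 - 2 * D \<alpha> + 1 / sqrt s"
      using s0 by (simp add: power2_eq_square field_simps)
    finally show ?thesis by simp
  qed
  have "(\<Sum>\<alpha>\<in>multi_indices K s. D \<alpha> * ?W \<alpha>) \<le>
      (\<Sum>\<alpha>\<in>multi_indices K s. (sqrt s * (D \<alpha>)\<^sup>2 + 1 / sqrt s) / 2 * ?W \<alpha>)"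
    by (intro sum_mono mult_right_mono amgm W0)
  also have "\<dots> = (sqrt s * (\<Sum>\<alpha>\<in>multi_indices K s. (D \<alpha>)\<^sup>2 * ?W \<alpha>)
      + 1 / sqrt s * (\<Sum>\<alpha>\<in>multi_indices K s. ?W \<alpha>)) / 2"
    by (simp add: sum.distrib sum_distrib_left sum_divide_distrib distrib_right add_divide_distrib
        mult.assoc)
  also have "\<dots> \<le> (sqrt s * (1 / real s) + 1 / sqrt s * 1) / 2"
    using var by (intro divide_right_mono add_mono mult_left_mono)
      (auto simp: multinomial_weight_total[OF p1])
  also have "\<dots> = 1 / sqrt s"
    using s0 by (simp add: real_div_sqrt field_simps)
  finally have mean: "(\<Sum>\<alpha>\<in>multi_indices K s. D \<alpha> * ?W \<alpha>) \<le> 1 / sqrt s" .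
  \<comment> \<open>As the weights sum to 1, \<open>\<omega> p\<close> is itself an average and
    moves inside the sum.\<close>
  have "\<omega> p - bernstein K s \<omega> p =
      (\<Sum>\<alpha>\<in>multi_indices K s. (\<omega> p - \<omega> (\<lambda>i. real (\<alpha> i) / real s)) * ?W \<alpha>)"
    by (simp add: bernstein_altdef left_diff_distrib sum_subtractf multinomial_weight_total[OF p1]
        flip: sum_distrib_left)
  also have "\<bar>\<dots>\<bar> \<le> (\<Sum>\<alpha>\<in>multi_indices K s. \<bar>\<omega> p - \<omega> (\<lambda>i. real (\<alpha> i) / real s)\<bar> * ?W \<alpha>)"
    by (rule order_trans[OF sum_abs]) (simp add: abs_mult W0)
  also have "\<dots> \<le> (\<Sum>\<alpha>\<in>multi_indices K s. M * D \<alpha> * ?W \<alpha>)"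
    unfolding D_def
    by (intro sum_mono mult_right_mono lip multi_index_in_prob_simplex W0 s)
  also have "\<dots> = M * (\<Sum>\<alpha>\<in>multi_indices K s. D \<alpha> * ?W \<alpha>)"
    by (simp add: sum_distrib_left mult.assoc)
  also have "\<dots> \<le> M * (1 / sqrt s)"
    using mean M by (rule mult_left_mono)
  finally show ?thesis by simp
qed

section \<open>Norms on finite-dimensional space\<close>

lemma Euclidean_space_diff:
  "x \<in> topspace (Euclidean_space d) \<Longrightarrow> y \<in> topspace (Euclidean_space d) \<Longrightarrow>
   x - y \<in> topspace (Euclidean_space d)"
  by (simp add: topspace_Euclidean_space)

context
  fixes d :: nat and N :: "(nat \<Rightarrow> real) \<Rightarrow> real"
  assumes N: "is_norm_on_Rn d N"
begin

lemma norm_on_Rn_nonneg: "x \<in> topspace (Euclidean_space d) \<Longrightarrow> 0 \<le> N x"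
  using N by (auto simp: is_norm_on_Rn_def)

lemma norm_on_Rn_zero_iff: "x \<in> topspace (Euclidean_space d) \<Longrightarrow> N x = 0 \<longleftrightarrow> x = 0"
  using N by (auto simp: is_norm_on_Rn_def)

lemma norm_on_Rn_scaleR: "x \<in> topspace (Euclidean_space d) \<Longrightarrow> N (r *\<^sub>R x) = \<bar>r\<bar> * N x"
  using N by (auto simp: is_norm_on_Rn_def)

lemma norm_on_Rn_triangle:
  "x \<in> topspace (Euclidean_space d) \<Longrightarrow> y \<in> topspace (Euclidean_space d) \<Longrightarrow> N (x + y) \<le> N x + N y"
  using N by (auto simp: is_norm_on_Rn_def)

lemma norm_on_Rn_minus_commute:
  assumes "x \<in> topspace (Euclidean_space d)" "y \<in> topspace (Euclidean_space d)"
  shows "N (x - y) = N (y - x)"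
proof -
  have "x - y = (-1) *\<^sub>R (y - x)" by simp
  then show ?thesis
    using norm_on_Rn_scaleR[of "y - x" "-1"] assms by (simp add: topspace_Euclidean_space)
qed

text \<open>Expand \<open>x\<close> in the unit vectors and apply the triangle inequality. This is
  the easy half of the equivalence of norms.\<close>

lemma norm_on_Rn_le_sum:
  assumes x: "x \<in> topspace (Euclidean_space d)"
  shows "N x \<le> (\<Sum>i<d. \<bar>x i\<bar> * N (\<lambda>j. of_bool (j = i)))"
proof -
  have e: "(\<lambda>j. of_bool (j = i)) \<in> topspace (Euclidean_space d)" if "i < d" for i
    using that by (auto simp: topspace_Euclidean_space)
  \<comment> \<open>Truncation to the first \<open>n\<close> coordinates, so that each induction
    step adds one multiple of a unit vector.\<close>
  define t where "t n = (\<lambda>j. if j < n then x j else 0)" for n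
  have "N (t n) \<le> (\<Sum>i<n. \<bar>x i\<bar> * N (\<lambda>j. of_bool (j = i)))" if "n \<le> d" for n
    using that
  proof (induction n)
    case 0
    have "t 0 = 0" by (simp add: t_def fun_eq_iff)
    then have "N (t 0) = 0"
      by (subst norm_on_Rn_zero_iff) (auto simp: topspace_Euclidean_space)
    then show ?case
      by simp
  next
    case (Suc n)
    have *: "t (Suc n) = t n + x n *\<^sub>R (\<lambda>j. of_bool (j = n))"
      by (auto simp: t_def fun_eq_iff less_Suc_eq)
    have "N (t (Suc n)) \<le> N (t n) + N (x n *\<^sub>R (\<lambda>j. of_bool (j = n)))"
      unfolding * using Suc.prems
      by (intro norm_on_Rn_triangle) (auto simp: t_def topspace_Euclidean_space)
    also have "N (x n *\<^sub>R (\<lambda>j. of_bool (j = n))) = \<bar>x n\<bar> * N (\<lambda>j. of_bool (j = n))"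
      using Suc.prems by (intro norm_on_Rn_scaleR e) simp
    finally show ?case
      using Suc by simp
  qed
  moreover have "t d = x"
    using x by (auto simp: t_def fun_eq_iff topspace_Euclidean_space)
  ultimately show ?thesis
    by fastforce
qed

text \<open>Links \<open>N\<close> to the product topology on functions: \<open>N (y - x)\<close> is
  dominated by a finite weighted sum of coordinate differences, which is continuous in
  \<open>y\<close> and vanishes at \<open>x\<close>.\<close>

lemma continuous_on_norm_bounded:
  assumes S: "S \<subseteq> topspace (Euclidean_space d)" and L: "0 \<le> L"
    and f: "\<And>x y. x \<in> S \<Longrightarrow> y \<in> S \<Longrightarrow> \<bar>f x - f y\<bar> \<le> L * N (x - y)"
  shows "continuous_on S (f :: (nat \<Rightarrow> real) \<Rightarrow> real)"
  unfolding continuous_on_def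
proof
  fix x assume x: "x \<in> S"
  let ?g = "\<lambda>y. L * (\<Sum>i<d. \<bar>y i - x i\<bar> * N (\<lambda>j. of_bool (j = i)))"
  have "((\<lambda>y. f y - f x) \<longlongrightarrow> 0) (at x within S)"
  proof (rule Lim_null_comparison[where g = ?g])
    show "\<forall>\<^sub>F y in at x within S. norm (f y - f x) \<le> ?g y"
      unfolding eventually_at_filter
    proof (intro always_eventually allI impI)
      fix y assume y: "y \<in> S"
      then have "y - x \<in> topspace (Euclidean_space d)"
        using x S by (blast intro: Euclidean_space_diff)
      from norm_on_Rn_le_sum[OF this] show "norm (f y - f x) \<le> ?g y"
        using order_trans[OF f[OF y x] mult_left_mono[OF _ L]] by simp
    qed
    have "continuous_on UNIV ?g"
      by (intro continuous_intros continuous_on_product_coordinates)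
    then have "(?g \<longlongrightarrow> ?g x) (at x)"
      unfolding continuous_on_def by (rule bspec) simp
    then show "(?g \<longlongrightarrow> 0) (at x within S)"
      using tendsto_within_subset[of ?g _ x UNIV S] by simp
  qed
  then show "(f \<longlongrightarrow> f x) (at x within S)"
    by (simp add: LIM_zero_iff)
qed

text \<open>The harder half of the equivalence of norms: \<open>N\<close> has a positive minimum on
  the compact unit sphere of the sum norm \<open>l\<close>, and homogeneity carries the bound to all
  vectors.\<close>

lemma norm_on_Rn_dominates:
  obtains C where "0 < C"
    and "\<And>x j. x \<in> topspace (Euclidean_space d) \<Longrightarrow> \<bar>x j\<bar> \<le> C * N x"
proof -
  let ?E = "topspace (Euclidean_space d)"
  define l where "l x = (\<Sum>i<d. \<bar>x i\<bar>)" for x :: "nat \<Rightarrow> real"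
  define B where "B = {x \<in> ?E. l x = 1}"
  have coord: "\<bar>x j\<bar> \<le> l x" if "x \<in> ?E" for x j
  proof (cases "j < d")
    case True
    then show ?thesis
      unfolding l_def by (intro member_le_sum[of j _ "\<lambda>i. \<bar>x i\<bar>"]) auto
  next
    case False
    then show ?thesis
      using that by (simp add: topspace_Euclidean_space l_def sum_nonneg)
  qed
  \<comment> \<open>By the reverse triangle inequality \<open>N\<close> is 1-Lipschitz with respect
    to itself.\<close>
  have "continuous_on B N"
  proof (rule continuous_on_norm_bounded[of _ 1])
    fix x y assume "x \<in> B" "y \<in> B"
    then have "x \<in> ?E" "y \<in> ?E" "x - y \<in> ?E" "y - x \<in> ?E"
      by (auto simp: B_def topspace_Euclidean_space)
    then show "\<bar>N x - N y\<bar> \<le> 1 * N (x - y)"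
      using norm_on_Rn_triangle[of "x - y" y] norm_on_Rn_triangle[of "y - x" x]
        norm_on_Rn_minus_commute[of x y] by simp
  qed (auto simp: B_def)
  moreover have "compact B"
  proof -
    \<comment> \<open>A cube whose coordinates from \<open>d\<close> onwards are pinned to 0. It is
      compact by Tychonoff, and the sphere is a closed slice of it.\<close>
    let ?P = "PiE UNIV (\<lambda>i::nat. if i < d then {-1..1::real} else {0})"
    have "compactin (product_topology (\<lambda>i. euclidean) UNIV) ?P"
      by (subst compactin_PiE) (auto simp: compactin_euclidean_iff)
    then have "compact ?P"
      by (simp add: euclidean_product_topology compactin_euclidean_iff)
    moreover have "closed {x. l x = 1}"
      unfolding l_def
      by (intro closed_Collect_eq continuous_intros continuous_on_product_coordinates)
    moreover have "B = ?P \<inter> {x. l x = 1}"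
    proof (intro equalityI subsetI)
      fix x assume x: "x \<in> B"
      then have "\<bar>x j\<bar> \<le> 1" for j
        using coord[of x j] by (simp add: B_def)
      then have "x j \<in> {-1..1}" for j
        by (simp add: abs_le_iff)
      then show "x \<in> ?P \<inter> {x. l x = 1}"
        using x by (auto simp: B_def topspace_Euclidean_space)
    next
      fix x assume x: "x \<in> ?P \<inter> {x. l x = 1}"
      then have "x i \<in> (if i < d then {-1..1} else {0})" for i
        by (auto simp: PiE_iff)
      then have "x i = 0" if "i \<ge> d" for i
        using that by (metis linorder_not_less singletonD)
      then show "x \<in> B"
        using x by (auto simp: B_def topspace_Euclidean_space)
    qed
    ultimately show ?thesis
      by (simp add: compact_Int_closed)
  qed
  ultimately have "\<exists>m>0. \<forall>x\<in>B. m \<le> N x"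
  proof (cases "B = {}")
    \<comment> \<open>The sphere is empty exactly when \<open>d = 0\<close>; then any positive
      \<open>m\<close> serves.\<close>
    case True
    then show ?thesis
      using zero_less_one by blast
  next
    case False
    assume "continuous_on B N" "compact B"
    then have "\<exists>z\<in>B. \<forall>x\<in>B. N z \<le> N x"
      by (intro continuous_attains_inf False)
    then obtain z where z: "z \<in> B" "\<And>x. x \<in> B \<Longrightarrow> N z \<le> N x"
      by (elim bexE) blast
    have "l 0 = 0"
      by (simp add: l_def)
    with z have "z \<noteq> 0" "z \<in> ?E"
      by (auto simp: B_def)
    then have "0 < N z"
      using norm_on_Rn_nonneg[of z] norm_on_Rn_zero_iff[of z] by simp
    with z show ?thesis by blast
  qed
  then obtain m where m: "0 < m" "\<And>x. x \<in> B \<Longrightarrow> m \<le> N x"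
    by blast
  show ?thesis
  proof (rule that[of "1 / m"])
    show "0 < 1 / m" using m by simp
    fix x j assume x: "x \<in> ?E"
    have "m * l x \<le> N x"
    proof (cases "l x = 0")
      case True
      then show ?thesis using norm_on_Rn_nonneg[OF x] by simp
    next
      case False
      then have l: "l x > 0"
        by (simp add: l_def order_less_le sum_nonneg)
      have "l ((1 / l x) *\<^sub>R x) = (\<Sum>i<d. \<bar>x i\<bar>) / l x"
        using l unfolding l_def[of "_ *\<^sub>R _"] by (simp add: abs_mult sum_divide_distrib)
      then have "(1 / l x) *\<^sub>R x \<in> B"
        using x l by (auto simp: B_def topspace_Euclidean_space simp flip: l_def)
      from m(2)[OF this] show ?thesis
        using l by (simp add: norm_on_Rn_scaleR[OF x] field_simps)
    qed
    then show "\<bar>x j\<bar> \<le> 1 / m * N x"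
      using coord[OF x, of j] m(1) by (simp add: field_simps) (smt (verit) mult_left_mono)
  qed
qed

end

section \<open>Stability of the minimiser\<close>

text \<open>\<open>Euclidean_space d\<close> is a subspace of the product topology, which is the
  type class topology on functions; theorems about \<open>compact\<close> thus become applicable to
  \<open>S\<close>.\<close>

lemma compactin_Euclidean_space_imp:
  assumes "compactin (Euclidean_space d) S"
  shows "compact S" "S \<subseteq> topspace (Euclidean_space d)"
  using assms
  by (auto simp: Euclidean_space_def compactin_subtopology euclidean_product_topology
      compactin_euclidean_iff)

lemma continuous_map_Euclidean_space_imp:
  assumes "continuous_map (subtopology (Euclidean_space d) S) euclideanreal f"
    and "S \<subseteq> topspace (Euclidean_space d)"
  shows "continuous_on S f"
proof -
  have "subtopology (Euclidean_space d) S = top_of_set S"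
    using assms(2)
    by (simp add: Euclidean_space_def subtopology_subtopology euclidean_product_topology Int_absorb1)
  then show ?thesis
    using assms(1) by simp
qed

text \<open>\<open>arg_min_on\<close> is a choice operator, so its minimality rests on the existence
  of some minimiser, supplied here by compactness.\<close>

lemma arg_min_on_attained:
  fixes f :: "'a :: topological_space \<Rightarrow> real"
  assumes "compact S" "S \<noteq> {}" "continuous_on S f"
  shows "arg_min_on f S \<in> S" "\<And>y. y \<in> S \<Longrightarrow> f (arg_min_on f S) \<le> f y"
proof -
  obtain x where "x \<in> S" "\<And>y. y \<in> S \<Longrightarrow> f x \<le> f y"
    using continuous_attains_inf[OF assms] by blast
  then have "is_arg_min f (\<lambda>x. x \<in> S) x"
    by (auto simp: is_arg_min_def not_less)
  then have "is_arg_min f (\<lambda>x. x \<in> S) (arg_min_on f S)"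
    unfolding arg_min_on_def arg_min_def by (rule someI)
  then show "arg_min_on f S \<in> S" "\<And>y. y \<in> S \<Longrightarrow> f (arg_min_on f S) \<le> f y"
    by (auto simp: is_arg_min_def not_less)
qed

text \<open>Evaluating at the midpoint costs a factor 2 against the optimal \<open>\<mu> / 2\<close> but needs no limit.\<close>

lemma strongly_convex_on_minimum:
  assumes f: "strongly_convex_on N \<mu> S f" and x: "x \<in> S" "\<And>z. z \<in> S \<Longrightarrow> f x \<le> f z"
    and y: "y \<in> S"
  shows "\<mu> / 4 * (N (x - y))\<^sup>2 \<le> f y - f x"
proof -
  let ?m = "(1/2) *\<^sub>R x + (1/2) *\<^sub>R y"
  have "?m \<in> S"
    using f x(1) y unfolding strongly_convex_on_def by (intro convexD) auto
  moreover have "f ?m \<le> 1/2 * f x + 1/2 * f y - \<mu> / 2 * (1/2) * (1/2) * (N (x - y))\<^sup>2"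
  proof -
    have "(0::real) \<le> 1/2" "1/2 + 1/2 = (1::real)" by simp_all
    with f x(1) y show ?thesis
      unfolding strongly_convex_on_def by blast
  qed
  ultimately show ?thesis
    using x(2)[of ?m] by (simp add: field_simps)
qed

text \<open>The modulus stems from \<phi> scaled by \<rho>; the weighted sum of the
  \<open>c k\<close> contributes plain convexity.\<close>

lemma strongly_convex_on_objective:
  assumes c: "\<And>k. k < K \<Longrightarrow> convex_on S (c k)" and p: "\<And>k. k < K \<Longrightarrow> 0 \<le> p k"
    and \<phi>: "strongly_convex_on N 1 S \<phi>" and \<rho>: "0 \<le> \<rho>"
  shows "strongly_convex_on N \<rho> S (\<lambda>w. (\<Sum>k<K. p k * c k w) + \<rho> * \<phi> w)"
  unfolding strongly_convex_on_def
proof (intro conjI ballI allI impI)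
  show "convex S"
    using \<phi> by (simp add: strongly_convex_on_def)
next
  fix x y and u v :: real
  assume xy: "x \<in> S" "y \<in> S" and uv: "0 \<le> u" "0 \<le> v" "u + v = 1"
  let ?m = "u *\<^sub>R x + v *\<^sub>R y"
  have "c k ?m \<le> u * c k x + v * c k y" if "k < K" for k
    using c[OF that] xy uv by (simp add: convex_on_def)
  then have "(\<Sum>k<K. p k * c k ?m) \<le> (\<Sum>k<K. p k * (u * c k x + v * c k y))"
    using p by (intro sum_mono mult_left_mono) auto
  also have "\<dots> = u * (\<Sum>k<K. p k * c k x) + v * (\<Sum>k<K. p k * c k y)"
    by (simp add: sum_distrib_left distrib_left sum.distrib mult_ac)
  finally have C: "(\<Sum>k<K. p k * c k ?m) \<le> u * (\<Sum>k<K. p k * c k x) + v * (\<Sum>k<K. p k * c k y)" .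
  have "\<phi> ?m \<le> u * \<phi> x + v * \<phi> y - 1 / 2 * u * v * (N (x - y))\<^sup>2"
    using \<phi> xy uv unfolding strongly_convex_on_def by blast
  then have "\<rho> * \<phi> ?m \<le> \<rho> * (u * \<phi> x + v * \<phi> y - 1 / 2 * u * v * (N (x - y))\<^sup>2)"
    using \<rho> by (rule mult_left_mono)
  with C show "(\<Sum>k<K. p k * c k ?m) + \<rho> * \<phi> ?m \<le>
      u * ((\<Sum>k<K. p k * c k x) + \<rho> * \<phi> x) + v * ((\<Sum>k<K. p k * c k y) + \<rho> * \<phi> y)
      - \<rho> / 2 * u * v * (N (x - y))\<^sup>2"
    by (simp add: algebra_simps)
qed

text \<open>Each minimiser is tested in the other's problem. Adding the two growth inequalities
  bounds a square of the distance by a product containing the distance once, and cancelling one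
  factor gives the Lipschitz bound.\<close>

lemma w_sol_stability:
  assumes N: "is_norm_on_Rn d N" and S: "S \<noteq> {}" "compactin (Euclidean_space d) S"
    and c: "\<And>k. k < K \<Longrightarrow> convex_on S (c k)"
    and \<phi>: "continuous_map (subtopology (Euclidean_space d) S) euclideanreal \<phi>"
    and lip: "Lipschitz_map_on N K L S c" and sc: "strongly_convex_on N 1 S \<phi>"
    and \<rho>: "\<rho> > 0" and pq: "p \<in> prob_simplex K" "q \<in> prob_simplex K"
  shows "w_sol K S c \<phi> \<rho> p \<in> S"
    and "N (w_sol K S c \<phi> \<rho> p - w_sol K S c \<phi> \<rho> q) \<le> 2 * L / \<rho> * L2_set (\<lambda>k. p k - q k) {..<K}"
proof -
  note S' = compactin_Euclidean_space_imp[OF S(2)]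
  have L: "0 \<le> L" and lip':
    "\<And>x y. x \<in> S \<Longrightarrow> y \<in> S \<Longrightarrow> L2_set (\<lambda>k. c k x - c k y) {..<K} \<le> L * N (x - y)"
    using lip by (auto simp: Lipschitz_map_on_def)
  \<comment> \<open>Continuity is drawn from the Lipschitz bound, since a convex function may jump
    at the boundary of \<open>S\<close>.\<close>
  have "continuous_on S (c k)" if k: "k < K" for k
  proof (rule continuous_on_norm_bounded[OF N S'(2) L])
    fix x y assume xy: "x \<in> S" "y \<in> S"
    have "\<bar>c k x - c k y\<bar> \<le> L2_set (\<lambda>k. \<bar>c k x - c k y\<bar>) {..<K}"
      using k by (intro member_le_L2_set) auto
    also have "\<dots> = L2_set (\<lambda>k. c k x - c k y) {..<K}"
      by (simp add: L2_set_def)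
    finally show "\<bar>c k x - c k y\<bar> \<le> L * N (x - y)"
      using lip'[OF xy] by simp
  qed
  then have cont: "continuous_on S (\<lambda>w. (\<Sum>k<K. p k * c k w) + \<rho> * \<phi> w)" for p
    using continuous_map_Euclidean_space_imp[OF \<phi> S'(2)] by (intro continuous_intros) auto
  note min = arg_min_on_attained[OF S'(1) S(1) cont, folded w_sol_def]
  show "w_sol K S c \<phi> \<rho> p \<in> S" by (rule min)
  let ?F = "\<lambda>p w. (\<Sum>k<K. p k * c k w) + \<rho> * \<phi> w"
  have growth: "\<rho> / 4 * (N (w_sol K S c \<phi> \<rho> p - y))\<^sup>2 \<le> ?F p y - ?F p (w_sol K S c \<phi> \<rho> p)"
    if "p \<in> prob_simplex K" "y \<in> S" for p y
  proof (rule strongly_convex_on_minimum[where f = "?F p"])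
    show "strongly_convex_on N \<rho> S (?F p)"
      using that \<rho> by (intro strongly_convex_on_objective c sc) (auto simp: prob_simplex_def)
  qed (fact min that)+
  define x where "x = w_sol K S c \<phi> \<rho> p"
  define y where "y = w_sol K S c \<phi> \<rho> q"
  have xy: "x \<in> S" "y \<in> S"
    unfolding x_def y_def by (rule min)+
  then have xyE: "x \<in> topspace (Euclidean_space d)" "y \<in> topspace (Euclidean_space d)"
    using S'(2) by auto
  \<comment> \<open>The growth inequalities at \<open>x\<close> and at \<open>y\<close> contribute
    \<open>\<rho> / 4\<close> each; this is the origin of the factor 2 in the bound.\<close>
  have "\<rho> / 2 * (N (x - y))\<^sup>2 \<le> (?F p y - ?F p x) + (?F q x - ?F q y)"
    using growth[OF pq(1) xy(2)] growth[OF pq(2) xy(1)] norm_on_Rn_minus_commute[OF N xyE]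
    by (simp flip: x_def y_def)
  \<comment> \<open>The \<phi>-terms at \<open>x\<close> and \<open>y\<close> occur with both signs
    and cancel.\<close>
  also have "\<dots> = (\<Sum>k<K. (p k - q k) * (c k y - c k x))"
    by (simp add: algebra_simps sum_subtractf sum.distrib)
  also have "\<dots> \<le> (\<Sum>k<K. \<bar>p k - q k\<bar> * \<bar>c k y - c k x\<bar>)"
    by (intro sum_mono) (metis abs_ge_self abs_mult)
  also have "\<dots> \<le> L2_set (\<lambda>k. p k - q k) {..<K} * L2_set (\<lambda>k. c k y - c k x) {..<K}"
    by (rule L2_set_mult_ineq)
  also have "\<dots> \<le> L2_set (\<lambda>k. p k - q k) {..<K} * (L * N (x - y))"
    using lip'[OF xy(2,1)] norm_on_Rn_minus_commute[OF N xyE]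
    by (intro mult_left_mono) auto
  finally have main: "\<rho> / 2 * (N (x - y))\<^sup>2 \<le> L2_set (\<lambda>k. p k - q k) {..<K} * (L * N (x - y))" .
  \<comment> \<open>Cancelling \<open>N (x - y)\<close> requires it to be positive; if it is zero,
    the right side is nonnegative anyway.\<close>
  have "N (x - y) \<le> 2 * L / \<rho> * L2_set (\<lambda>k. p k - q k) {..<K}"
  proof (cases "N (x - y) = 0")
    case True
    then show ?thesis
      using L \<rho> by simp
  next
    case False
    then have "0 < N (x - y)"
      using norm_on_Rn_nonneg[OF N, of "x - y"] xyE by (auto simp: topspace_Euclidean_space)
    moreover have "(\<rho> / 2 * N (x - y)) * N (x - y) \<le> (L * L2_set (\<lambda>k. p k - q k) {..<K}) * N (x - y)"
      using main by (simp add: power2_eq_square mult_ac)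
    ultimately have "\<rho> / 2 * N (x - y) \<le> L * L2_set (\<lambda>k. p k - q k) {..<K}"
      by (rule mult_right_le_imp_le[rotated])
    then show ?thesis
      using \<rho> by (simp add: field_simps)
  qed
  then show "N (w_sol K S c \<phi> \<rho> p - w_sol K S c \<phi> \<rho> q) \<le>
      2 * L / \<rho> * L2_set (\<lambda>k. p k - q k) {..<K}"
    by (simp add: x_def y_def)
qed

text \<open>Coordinate \<open>j\<close> of the solution map is Lipschitz with constant
  \<open>C * (2 * L / \<rho>)\<close>, where \<open>C\<close> converts \<open>N\<close> into
  coordinate differences; \<open>bernstein_error\<close> then applies.\<close>

lemma w_approx_error:
  assumes N: "is_norm_on_Rn d N" and S: "S \<noteq> {}" "compactin (Euclidean_space d) S"
    and c: "\<And>k. k < K \<Longrightarrow> convex_on S (c k)"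
    and \<phi>: "continuous_map (subtopology (Euclidean_space d) S) euclideanreal \<phi>"
    and lip: "Lipschitz_map_on N K L S c" and sc: "strongly_convex_on N 1 S \<phi>"
    and \<rho>: "\<rho> > 0" and s: "s \<ge> 1" and p: "p \<in> prob_simplex K"
    and C: "0 \<le> C" "\<And>x. x \<in> topspace (Euclidean_space d) \<Longrightarrow> \<bar>x j\<bar> \<le> C * N x"
  shows "\<bar>w_sol K S c \<phi> \<rho> p j - w_approx s K S c \<phi> \<rho> p j\<bar> \<le> 2 * C * L / (\<rho> * sqrt (real s))"
proof -
  let ?w = "w_sol K S c \<phi> \<rho>"
  note w = w_sol_stability[OF N S c \<phi> lip sc \<rho>]
  have "\<bar>?w p j - bernstein K s (\<lambda>q. ?w q j) p\<bar> \<le> (C * (2 * L / \<rho>)) / sqrt s"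
  proof (rule bernstein_error[OF p s])
    show "0 \<le> C * (2 * L / \<rho>)"
      using lip C \<rho> by (simp add: Lipschitz_map_on_def)
    fix q assume q: "q \<in> prob_simplex K"
    have "?w p \<in> topspace (Euclidean_space d)" "?w q \<in> topspace (Euclidean_space d)"
      using w(1)[OF _ p q] w(1)[OF _ q p] compactin_Euclidean_space_imp(2)[OF S(2)] by auto
    then have "?w p - ?w q \<in> topspace (Euclidean_space d)"
      by (auto simp: topspace_Euclidean_space)
    from C(2)[OF this] have "\<bar>?w p j - ?w q j\<bar> \<le> C * N (?w p - ?w q)"
      by simp
    also have "\<dots> \<le> C * (2 * L / \<rho> * L2_set (\<lambda>k. p k - q k) {..<K})"
      using w(2)[OF _ p q] C(1) by (intro mult_left_mono) auto
    finally show "\<bar>?w p j - ?w q j\<bar> \<le> C * (2 * L / \<rho>) * L2_set (\<lambda>k. p k - q k) {..<K}"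
      by (simp add: mult.assoc)
  qed
  then show ?thesis
    by (simp add: w_approx_def mult_ac)
qed

text \<open>The quantifier order expresses the uniformity: \<open>\<Omega>\<^sub>0\<close> precedes
  all data and serves every norm that dominates coordinates, while for other norms the constant may
  depend on \<open>d\<close> and \<open>N\<close> but on nothing chosen later.\<close>

theorem proposition3:
  shows "\<exists>\<Omega>\<^sub>0::real. \<Omega>\<^sub>0 > 0 \<and>
    (\<forall>(d::nat) (N :: (nat \<Rightarrow> real) \<Rightarrow> real). d \<ge> 1 \<longrightarrow> is_norm_on_Rn d N \<longrightarrow>
      (\<exists>\<Omega>::real. \<Omega> > 0 \<and> (dominates_coordinates d N \<longrightarrow> \<Omega> = \<Omega>\<^sub>0) \<and>
        (\<forall>(K::nat) (S :: (nat \<Rightarrow> real) set) (c :: nat \<Rightarrow> (nat \<Rightarrow> real) \<Rightarrow> real)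
          (\<phi> :: (nat \<Rightarrow> real) \<Rightarrow> real) (L\<^sub>c::real) (\<rho>::real) (s::nat).
          K \<ge> 1 \<longrightarrow>
          S \<noteq> {} \<longrightarrow> convex S \<longrightarrow> compactin (Euclidean_space d) S \<longrightarrow>
          (\<forall>k<K. convex_on S (c k)) \<longrightarrow>
          (\<forall>w\<in>S. 0 \<le> \<phi> w) \<longrightarrow>
          continuous_map (subtopology (Euclidean_space d) S) euclideanreal \<phi> \<longrightarrow>
          Lipschitz_map_on N K L\<^sub>c S c \<longrightarrow>
          strongly_convex_on N 1 S \<phi> \<longrightarrow>
          \<rho> > 0 \<longrightarrow> s \<ge> 1 \<longrightarrow>
          (\<forall>p\<in>prob_simplex K. \<forall>j<d.
             \<bar>w_sol K S c \<phi> \<rho> p j - w_approx s K S c \<phi> \<rho> p j\<bar> \<le> \<Omega> * L\<^sub>c / (\<rho> * sqrt (real s))))))"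
proof (rule exI[of _ 2], intro conjI allI impI)
  show "(0::real) < 2" by simp
next
  fix d :: nat and N :: "(nat \<Rightarrow> real) \<Rightarrow> real"
  assume N: "is_norm_on_Rn d N"
  \<comment> \<open>Under the normalisation \<open>C = 1\<close> works directly; otherwise
    equivalence of norms supplies some \<open>C\<close>, fixed before \<open>K\<close>,
    \<open>S\<close> and the functions.\<close>
  obtain C where C: "0 < C" "dominates_coordinates d N \<longrightarrow> C = 1"
    "\<And>x j. x \<in> topspace (Euclidean_space d) \<Longrightarrow> j < d \<Longrightarrow> \<bar>x j\<bar> \<le> C * N x"
  proof (cases "dominates_coordinates d N")
    case True
    then show ?thesis
      using that[of 1] by (auto simp: dominates_coordinates_def)
  next
    case False
    then show ?thesis
      using norm_on_Rn_dominates[OF N] that by metis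
  qed
  show "\<exists>\<Omega>::real. \<Omega> > 0 \<and> (dominates_coordinates d N \<longrightarrow> \<Omega> = 2) \<and>
        (\<forall>(K::nat) (S :: (nat \<Rightarrow> real) set) (c :: nat \<Rightarrow> (nat \<Rightarrow> real) \<Rightarrow> real)
          (\<phi> :: (nat \<Rightarrow> real) \<Rightarrow> real) (L\<^sub>c::real) (\<rho>::real) (s::nat).
          K \<ge> 1 \<longrightarrow>
          S \<noteq> {} \<longrightarrow> convex S \<longrightarrow> compactin (Euclidean_space d) S \<longrightarrow>
          (\<forall>k<K. convex_on S (c k)) \<longrightarrow>
          (\<forall>w\<in>S. 0 \<le> \<phi> w) \<longrightarrow>
          continuous_map (subtopology (Euclidean_space d) S) euclideanreal \<phi> \<longrightarrow>
          Lipschitz_map_on N K L\<^sub>c S c \<longrightarrow>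
          strongly_convex_on N 1 S \<phi> \<longrightarrow>
          \<rho> > 0 \<longrightarrow> s \<ge> 1 \<longrightarrow>
          (\<forall>p\<in>prob_simplex K. \<forall>j<d.
             \<bar>w_sol K S c \<phi> \<rho> p j - w_approx s K S c \<phi> \<rho> p j\<bar> \<le> \<Omega> * L\<^sub>c / (\<rho> * sqrt (real s))))"
  \<comment> \<open>The 2 is the stability factor, so \<open>C = 1\<close> yields the absolute
    constant 2.\<close>
  proof (rule exI[of _ "2 * C"], intro conjI allI impI ballI)
    show "0 < 2 * C" "dominates_coordinates d N \<Longrightarrow> 2 * C = 2"
      using C by simp_all
  next
    fix K :: nat and S c \<phi> and L\<^sub>c \<rho> :: real and s :: nat and p j
    assume S: "S \<noteq> {}" "compactin (Euclidean_space d) S" and c: "\<forall>k<K. convex_on S (c k)"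
      and \<phi>: "continuous_map (subtopology (Euclidean_space d) S) euclideanreal \<phi>"
      and lip: "Lipschitz_map_on N K L\<^sub>c S c" and sc: "strongly_convex_on N 1 S \<phi>"
      and \<rho>: "0 < \<rho>" and s: "1 \<le> s" and p: "p \<in> prob_simplex K" and j: "j < d"
    show "\<bar>w_sol K S c \<phi> \<rho> p j - w_approx s K S c \<phi> \<rho> p j\<bar> \<le> 2 * C * L\<^sub>c / (\<rho> * sqrt (real s))"
    proof (rule w_approx_error[OF N S _ \<phi> lip sc \<rho> s p])
      show "convex_on S (c k)" if "k < K" for k
        using c that by blast
      show "0 \<le> C"
        using C(1) by simp
      show "\<bar>x j\<bar> \<le> C * N x" if "x \<in> topspace (Euclidean_space d)" for x
        using C(3) that j by blast
    qed
  qed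
qed

end
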